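(* Let $(\hat c_n)_{n\ge 0}$, $(\hat d_m)_{m\ge 0}$, $(\hat a_{n+1})_{n\ge 0}$, $(\hat b_{m+1})_{m\ge 0}$ be sequences of complex numbers that correspond to a perfect system $(f_1,f_2)$. Then the boundary value problem consisting of the difference equations $$c_{n,m+1}=c_{n,m}+\frac{(a+b)_{n+1,m}-(a+b)_{n,m+1}}{(c-d)_{n,m}},\qquad d_{n+1,m}=d_{n,m}+\frac{(a+b)_{n+1,m}-(a+b)_{n,m+1}}{(c-d)_{n,m}}\qquad(n,m\ge 0),$$ $$a_{n,m+1}=a_{n,m}\frac{(c-d)_{n,m}}{(c-d)_{n-1,m}}\quad(n\ge 1,\ m\ge 0),\qquad b_{n+1,m}=b_{n,m}\frac{(c-d)_{n,m}}{(c-d)_{n,m-1}}\quad(n\ge 0,\ m\ge 1),$$ and the boundary conditions $$a_{0,m}=0,\quad d_{0,m}=\hat d_m,\quad b_{0,m+1}=\hat b_{m+1}\quad(m\ge 0),\qquad b_{n,0}=0,\quad c_{n,0}=\hat c_n,\quad a_{n+1,0}=\hat a_{n+1}\quad(n\ge 0),$$ has a solution, and it satisfies $a_{n+1,0}=\hat a_{n+1}\neq 0$ and $b_{0,m+1}=\hat b_{m+1}\ne 0$ for all $n,m\ge 0$. Furthermore, the problem can be solved as follows. The initial data determine the family of monic Hermite-Padé polynomials $P_{n,m}$ ($n,m\ge 0$) of $(f_1,f_2)$. The functions $$m_-^{(1)}(z,n,m)=-\frac{P_{n,m}(z)}{P_{n+1,m}(z)},\qquad m_-^{(2)}(z,n,m)=-\frac{P_{n,m}(z)}{P_{n,m+1}(z)}$$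 admit the (finite, branched) continued fraction expansions $$m_-^{(1)}(z,n,m)=-\cfrac{1}{z-c_{n,m}-\cfrac{a_{n,m}}{z-c_{n-1,m}-\cdots}-\cfrac{b_{n,m}}{z-d_{n,m-1}-\cdots}},$$ $$m_-^{(2)}(z,n,m)=-\cfrac{1}{z-d_{n,m}-\cfrac{a_{n,m}}{z-c_{n-1,m}-\cdots}-\cfrac{b_{n,m}}{z-d_{n,m-1}-\cdots}},$$ and these expansions determine the solution $(c,a)_{n,m}$, $(d,b)_{n,m}$ of the boundary value problem, i.e. the numbers $a_{n,m},b_{n,m},c_{n,m},d_{n,m}$ are uniquely determined by the functions $m_-^{(1)},m_-^{(2)}$.
   Context: $\mathbb{Z}_+=\{0,1,2,\dots\}$. Notation: $(a+b)_{n,m}=a_{n,m}+b_{n,m}$, $(c-d)_{n,m}=c_{n,m}-d_{n,m}$; a solution consists of complex arrays for which all denominators $(c-d)_{n,m}$ are nonzero. Let $f_j(z)=\sum_{k\ge 0}s_{j,k}z^{-k-1}$, $j=1,2$, be (formal) Laurent series at infinity with complex coefficients. For $(n_1,n_2)\in\mathbb{Z}_+^2$, a (type II) Hermite-Padé polynomial for $(f_1,f_2)$ is a nonzero polynomial $P_{n_1,n_2}$ with $\deg P_{n_1,n_2}\le n_1+n_2$ such that for $j=1,2$ there is a polynomial $Q^{(j)}$ with $f_j(z)P_{n_1,n_2}(z)-Q^{(j)}(z)=\mathcal{O}(z^{-n_j-1})$ as $z\to\infty$. The index $(n_1,n_2)$ is normal if $P_{n_1,n_2}$ is unique up to a multiplicative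 constant and every nontrivial solution has full degree $n_1+n_2$; then it is normalized to be monic. The system $(f_1,f_2)$ is perfect if all indices in $\mathbb{Z}_+^2$ are normal. In that case $P_{n,m}(x)=D_{n,m}(x)/S_{n,m}$, where $S_{n,m}\neq 0$ is the determinant of size $n+m$ whose row $i$ ($0\le i\le n+m-1$) is $(s_{1,i},\dots,s_{1,i+n-1},s_{2,i},\dots,s_{2,i+m-1})$ and $D_{n,m}(x)$ is the determinant of size $n+m+1$ whose row $i$ ($0\le i\le n+m$) is $(s_{1,i},\dots,s_{1,i+n-1},s_{2,i},\dots,s_{2,i+m-1},x^i)$. The data $\hat c_n,\hat d_m,\hat a_{n+1},\hat b_{m+1}$ correspond to the perfect system $(f_1,f_2)$ if they are the entries of the $J$-fraction representations (with nonzero partial numerators) $$f_1(z)\sim-\cfrac{1}{z-\hat c_0-\cfrac{\hat a_1}{z-\hat c_1-\cfrac{\hat a_2}{\ddots}}},\qquad f_2(z)\sim-\cfrac{1}{z-\hat d_0-\cfrac{\hat b_1}{z-\hat d_1-\cfrac{\hat b_2}{\ddots}}},$$ where $\sim$ means equality of formal Laurent series at infinity. The branched continued fractions are understood as the result of iterating, for all $n,m\ge 0$, $$m_-^{(1)}(z,n,m)=\frac{-1}{z-c_{n,m}+a_{n,m}m_-^{(1)}(z,n-1,m)+b_{n,m}m_-^{(2)}(z,n,m-1)},$$ $$m_-^{(2)}(z,n,m)=\frac{-1}{z-d_{n,m}+a_{n,m}m_-^{(1)}(z,n-1,m)+b_{n,m}m_-^{(2)}(z,n,m-1)},$$ where the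 terms with $a_{0,m}=0$ or $b_{n,0}=0$ are absent, so that the expansion terminates. *)

theory Defs
  imports
    "HOL-Computational_Algebra.Formal_Laurent_Series"
    "HOL-Computational_Algebra.Polynomial_Factorial"
begin

(* Formal Laurent series at infinity in z are represented as Laurent series in the variable
   1/z: fls_X stands for 1/z and fls_X_inv for z. The coefficient of z^(-i) is the i-th one. *)

definition series_at_inf :: "(nat \<Rightarrow> complex) \<Rightarrow> complex fls" where
  "series_at_inf s = fls_X * fps_to_fls (Abs_fps s)"

definition poly_at_inf :: "complex poly \<Rightarrow> complex fls" where
  "poly_at_inf p = poly (map_poly fls_const p) fls_X_inv"

definition hp_interpolates :: "complex fls \<Rightarrow> nat \<Rightarrow> complex poly \<Rightarrow> bool" where
  "hp_interpolates f k P \<longleftrightarrow>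
     (\<exists>Q. \<forall>i \<le> int k. fls_nth (f * poly_at_inf P - poly_at_inf Q) i = 0)"

definition hermite_pade :: "complex fls \<Rightarrow> complex fls \<Rightarrow> nat \<Rightarrow> nat \<Rightarrow> complex poly \<Rightarrow> bool" where
  "hermite_pade f1 f2 n m P \<longleftrightarrow>
     P \<noteq> 0 \<and> degree P \<le> n + m \<and> hp_interpolates f1 n P \<and> hp_interpolates f2 m P"

definition monic_hermite_pade ::
    "complex fls \<Rightarrow> complex fls \<Rightarrow> nat \<Rightarrow> nat \<Rightarrow> complex poly \<Rightarrow> bool" where
  "monic_hermite_pade f1 f2 n m P \<longleftrightarrow> hermite_pade f1 f2 n m P \<and> lead_coeff P = 1"

definition normal_index :: "complex fls \<Rightarrow> complex fls \<Rightarrow> nat \<Rightarrow> nat \<Rightarrow> bool" where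
  "normal_index f1 f2 n m \<longleftrightarrow>
     (\<exists>P. hermite_pade f1 f2 n m P \<and> (\<forall>R. hermite_pade f1 f2 n m R \<longrightarrow> (\<exists>r. R = smult r P))) \<and>
     (\<forall>R. hermite_pade f1 f2 n m R \<longrightarrow> degree R = n + m)"

definition perfect_system :: "complex fls \<Rightarrow> complex fls \<Rightarrow> bool" where
  "perfect_system f1 f2 \<longleftrightarrow> (\<forall>n m. normal_index f1 f2 n m)"

(* jfrac_conv \<gamma> \<alpha> N k is the J-fraction
     1 / (z - \<gamma> k - \<alpha> (k+1) / (z - \<gamma> (k+1) - \<alpha> (k+2) / ...))
   truncated after N levels. *)

primrec jfrac_conv ::
    "(nat \<Rightarrow> complex) \<Rightarrow> (nat \<Rightarrow> complex) \<Rightarrow> nat \<Rightarrow> nat \<Rightarrow> complex fls" where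
  "jfrac_conv \<gamma> \<alpha> 0 k = 0"
| "jfrac_conv \<gamma> \<alpha> (Suc N) k =
     1 / (fls_X_inv - fls_const (\<gamma> k) - fls_const (\<alpha> (k + 1)) * jfrac_conv \<gamma> \<alpha> N (k + 1))"

(* The value of the infinite fraction is the limit of its convergents in the (1/z)-adic metric
   of complex fls. The entry \<alpha> 0 plays no role. *)

definition has_jfrac :: "complex fls \<Rightarrow> (nat \<Rightarrow> complex) \<Rightarrow> (nat \<Rightarrow> complex) \<Rightarrow> bool" where
  "has_jfrac f \<gamma> \<alpha> \<longleftrightarrow>
     (\<forall>n. \<alpha> (n + 1) \<noteq> 0) \<and> (\<lambda>N. - jfrac_conv \<gamma> \<alpha> N 0) \<longlonglongrightarrow> f"

definition corresponds_to_perfect ::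
    "(nat \<Rightarrow> complex) \<Rightarrow> (nat \<Rightarrow> complex) \<Rightarrow> (nat \<Rightarrow> complex) \<Rightarrow> (nat \<Rightarrow> complex) \<Rightarrow>
     (nat \<Rightarrow> complex) \<Rightarrow> (nat \<Rightarrow> complex) \<Rightarrow> bool" where
  "corresponds_to_perfect ch dh ah bh s1 s2 \<longleftrightarrow>
     perfect_system (series_at_inf s1) (series_at_inf s2) \<and>
     has_jfrac (series_at_inf s1) ch ah \<and> has_jfrac (series_at_inf s2) dh bh"

definition difference_equations ::
    "(nat \<Rightarrow> nat \<Rightarrow> complex) \<Rightarrow> (nat \<Rightarrow> nat \<Rightarrow> complex) \<Rightarrow>
     (nat \<Rightarrow> nat \<Rightarrow> complex) \<Rightarrow> (nat \<Rightarrow> nat \<Rightarrow> complex) \<Rightarrow> bool" where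
  "difference_equations c d a b \<longleftrightarrow>
     (\<forall>n m. c n m - d n m \<noteq> 0) \<and>
     (\<forall>n m. c n (m+1) = c n m +
        ((a (n+1) m + b (n+1) m) - (a n (m+1) + b n (m+1))) / (c n m - d n m)) \<and>
     (\<forall>n m. d (n+1) m = d n m +
        ((a (n+1) m + b (n+1) m) - (a n (m+1) + b n (m+1))) / (c n m - d n m)) \<and>
     (\<forall>n\<ge>1. \<forall>m. a n (m+1) = a n m * ((c n m - d n m) / (c (n-1) m - d (n-1) m))) \<and>
     (\<forall>n. \<forall>m\<ge>1. b (n+1) m = b n m * ((c n m - d n m) / (c n (m-1) - d n (m-1))))"

definition boundary_conditions ::
    "(nat \<Rightarrow> complex) \<Rightarrow> (nat \<Rightarrow> complex) \<Rightarrow> (nat \<Rightarrow> complex) \<Rightarrow> (nat \<Rightarrow> complex) \<Rightarrow>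
     (nat \<Rightarrow> nat \<Rightarrow> complex) \<Rightarrow> (nat \<Rightarrow> nat \<Rightarrow> complex) \<Rightarrow>
     (nat \<Rightarrow> nat \<Rightarrow> complex) \<Rightarrow> (nat \<Rightarrow> nat \<Rightarrow> complex) \<Rightarrow> bool" where
  "boundary_conditions ch dh ah bh c d a b \<longleftrightarrow>
     (\<forall>m. a 0 m = 0 \<and> d 0 m = dh m \<and> b 0 (m+1) = bh (m+1)) \<and>
     (\<forall>n. b n 0 = 0 \<and> c n 0 = ch n \<and> a (n+1) 0 = ah (n+1))"

abbreviation ratfun_z :: "complex poly fract" where
  "ratfun_z \<equiv> to_fract [:0, 1:]"

abbreviation ratfun_const :: "complex \<Rightarrow> complex poly fract" where
  "ratfun_const x \<equiv> to_fract [:x:]"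

(* The finite branched continued fractions, as rational functions of z. *)

fun bcf1 :: "(nat \<Rightarrow> nat \<Rightarrow> complex) \<Rightarrow> (nat \<Rightarrow> nat \<Rightarrow> complex) \<Rightarrow>
     (nat \<Rightarrow> nat \<Rightarrow> complex) \<Rightarrow> (nat \<Rightarrow> nat \<Rightarrow> complex) \<Rightarrow> nat \<Rightarrow> nat \<Rightarrow> complex poly fract"
and bcf2 :: "(nat \<Rightarrow> nat \<Rightarrow> complex) \<Rightarrow> (nat \<Rightarrow> nat \<Rightarrow> complex) \<Rightarrow>
     (nat \<Rightarrow> nat \<Rightarrow> complex) \<Rightarrow> (nat \<Rightarrow> nat \<Rightarrow> complex) \<Rightarrow> nat \<Rightarrow> nat \<Rightarrow> complex poly fract"
where
  "bcf1 c d a b n m =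
     - 1 / (ratfun_z - ratfun_const (c n m)
        + (if n = 0 then 0 else ratfun_const (a n m) * bcf1 c d a b (n - 1) m)
        + (if m = 0 then 0 else ratfun_const (b n m) * bcf2 c d a b n (m - 1)))"
| "bcf2 c d a b n m =
     - 1 / (ratfun_z - ratfun_const (d n m)
        + (if n = 0 then 0 else ratfun_const (a n m) * bcf1 c d a b (n - 1) m)
        + (if m = 0 then 0 else ratfun_const (b n m) * bcf2 c d a b n (m - 1)))"

declare bcf1.simps [simp del] bcf2.simps [simp del]

definition m_minus1 :: "(nat \<Rightarrow> nat \<Rightarrow> complex poly) \<Rightarrow> nat \<Rightarrow> nat \<Rightarrow> complex poly fract" where
  "m_minus1 P n m = - (to_fract (P n m) / to_fract (P (n+1) m))"

definition m_minus2 :: "(nat \<Rightarrow> nat \<Rightarrow> complex poly) \<Rightarrow> nat \<Rightarrow> nat \<Rightarrow> complex poly fract" where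
  "m_minus2 P n m = - (to_fract (P n m) / to_fract (P n (m+1)))"

(* Division by zero yields 0 in complex poly fract, but m_minus1 and m_minus2 have nonzero
   values for nonzero P, so the equalities below force all denominators to be nonzero. *)

definition has_bcf_expansions ::
    "(nat \<Rightarrow> nat \<Rightarrow> complex poly) \<Rightarrow> (nat \<Rightarrow> nat \<Rightarrow> complex) \<Rightarrow> (nat \<Rightarrow> nat \<Rightarrow> complex) \<Rightarrow>
     (nat \<Rightarrow> nat \<Rightarrow> complex) \<Rightarrow> (nat \<Rightarrow> nat \<Rightarrow> complex) \<Rightarrow> bool" where
  "has_bcf_expansions P c d a b \<longleftrightarrow>
     (\<forall>m. a 0 m = 0) \<and> (\<forall>n. b n 0 = 0) \<and>
     (\<forall>n m. m_minus1 P n m = bcf1 c d a b n m \<and> m_minus2 P n m = bcf2 c d a b n m)"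

end

theory Submission
  imports Defs
begin

text \<open>
  The solution is the family of coefficients in the nearest neighbour recurrences of the monic
  Hermite-Pade polynomials \<open>P n m\<close> (\<open>hp n m\<close> below). The interpolation conditions say that \<open>P n m\<close> is orthogonal:
  the first \<open>n\<close> moments against \<open>f1\<close> and the first \<open>m\<close> moments against \<open>f2\<close> vanish. In a perfect
  system a polynomial with these vanishing moments and of degree at most \<open>n + m\<close> is a multiple of
  \<open>P n m\<close> (\<open>orthogonal_imp_multiple\<close>). Hence \<open>P (n+1) m - P n (m+1)\<close> is a multiple of \<open>P n m\<close>,
  and subtracting suitable multiples of \<open>P (n-1) m\<close> and \<open>P n (m-1)\<close> from \<open>z P n m\<close> gives
  \[ z P_{n,m} = P_{n+1,m} + c_{n,m} P_{n,m} + a_{n,m} P_{n-1,m} + b_{n,m} P_{n,m-1}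
     = P_{n,m+1} + d_{n,m} P_{n,m} + a_{n,m} P_{n-1,m} + b_{n,m} P_{n,m-1}. \]
  So \<open>P (n+1) m - P n (m+1) = (d - c) P n m\<close>, and \<open>c - d\<close> does not vanish, since two equal
  neighbours would be a Hermite-Pade polynomial of index \<open>(n+1, m+1)\<close> of too small a degree.

  Three things follow from the recurrences. Taking the first non-vanishing moment of the
  difference of two neighbours gives the equations for \<open>a\<close> and \<open>b\<close>. Comparing the two ways
  of expanding \<open>z (P (n+1) m - P n (m+1))\<close> gives the equations for \<open>c\<close> and \<open>d\<close>
  (\<open>compatibility\<close>). Dividing by \<open>P n m\<close> turns the recurrences into one step of the branched
  continued fractions, and this step can be reversed (\<open>has_bcf_expansions_iff\<close>). The expansions
  are therefore unique because \<open>P n m\<close>, \<open>P (n-1) m\<close> and \<open>P n (m-1)\<close> are linearly independent;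
  for the last two this again uses that \<open>c - d\<close> does not vanish.

  On the axes \<open>P n 0\<close> and \<open>P 0 m\<close> are the denominators of the convergents of the two
  J-fractions (\<open>jdenom_interpolates\<close>). Their classical three-term recurrence is the nearest
  neighbour recurrence there, which gives the boundary values. A J-fraction has only one
  value, so the data determine \<open>f1\<close>, \<open>f2\<close> and thereby all \<open>P n m\<close>.
\<close>

section \<open>Polynomials as Laurent series at infinity, and their moments\<close>

lemma poly_at_inf_0 [simp]: "poly_at_inf 0 = 0"
  by (simp add: poly_at_inf_def)

lemma poly_at_inf_pCons: "poly_at_inf (pCons c p) = fls_const c + fls_X_inv * poly_at_inf p"
  by (simp add: poly_at_inf_def map_poly_pCons)

lemma poly_at_inf_smult: "poly_at_inf (smult c p) = fls_const c * poly_at_inf p"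
  by (simp add: poly_at_inf_def map_poly_smult)

lemma poly_at_inf_diff: "poly_at_inf (p - q) = poly_at_inf p - poly_at_inf q"
proof -
  have "map_poly fls_const (p - q) = map_poly fls_const p - map_poly fls_const q"
    by (intro poly_eqI) (simp add: coeff_map_poly fls_eq_iff)
  then show ?thesis by (simp add: poly_at_inf_def)
qed

lemma fls_nth_poly_at_inf:
  "fls_nth (poly_at_inf p) i = (if i \<le> 0 then coeff p (nat (- i)) else 0)"
proof (induction p arbitrary: i)
  case 0
  then show ?case by simp
next
  case (pCons c p)
  show ?case
  proof (cases "i < 0")
    case True
    then have "nat (- i) = Suc (nat (- (i + 1)))" by simp
    then show ?thesis
      using True pCons.IH[of "i + 1"]
      by (simp add: poly_at_inf_pCons fls_X_inv_times_conv_shift)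
  next
    case False
    then show ?thesis
      using pCons.IH[of "i + 1"]
      by (simp add: poly_at_inf_pCons fls_X_inv_times_conv_shift)
  qed
qed

text \<open>
  The coefficient of \<open>z\<close> to the power \<open>- (k + 1)\<close> in \<open>f p\<close>. When \<open>f\<close> is the series
  of moments of a linear functional, it is the value of that functional at \<open>z ^ k * p\<close>, which is
  why multiplication of \<open>p\<close> by \<open>z\<close> shifts \<open>k\<close>.
\<close>

definition moment :: "complex fls \<Rightarrow> nat \<Rightarrow> complex poly \<Rightarrow> complex" where
  "moment f k p = fls_nth (f * poly_at_inf p) (int k + 1)"

lemma moment_0 [simp]: "moment f k 0 = 0"
  by (simp add: moment_def)

lemma moment_diff [simp]: "moment f k (p - q) = moment f k p - moment f k q"
  by (simp add: moment_def poly_at_inf_diff algebra_simps)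

lemma moment_smult [simp]: "moment f k (smult c p) = c * moment f k p"
proof -
  have eq: "f * poly_at_inf (smult c p) = fls_const c * (f * poly_at_inf p)"
    by (simp add: poly_at_inf_smult)
  show ?thesis unfolding moment_def eq by simp
qed

lemma moment_pCons_0 [simp]: "moment f k (pCons 0 p) = moment f (Suc k) p"
proof -
  have "f * poly_at_inf (pCons 0 p) = fls_X_inv * (f * poly_at_inf p)"
    by (simp add: poly_at_inf_pCons)
  then show ?thesis by (simp add: moment_def fls_X_inv_times_conv_shift add.commute)
qed

lemma exists_polynomial_part:
  obtains q where "\<And>i. i \<le> 0 \<Longrightarrow> fls_nth (poly_at_inf q) i = fls_nth g i"
proof
  define q where "q = Poly (map (\<lambda>j. fls_nth g (- int j)) [0..<Suc (nat (- fls_subdegree g))])"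
  fix i :: int
  assume i: "i \<le> 0"
  show "fls_nth (poly_at_inf q) i = fls_nth g i"
  proof (cases "nat (- i) < Suc (nat (- fls_subdegree g))")
    case True
    then show ?thesis
      using i by (simp add: fls_nth_poly_at_inf q_def coeff_Poly_eq nth_default_def del: upt_Suc)
  next
    case False
    then have "i < fls_subdegree g" using i by linarith
    then show ?thesis
      using i False by (simp add: fls_nth_poly_at_inf q_def coeff_Poly_eq nth_default_def del: upt_Suc)
  qed
qed

text \<open>
  The polynomial \<open>Q\<close> is free to cancel the coefficients of all nonnegative powers of \<open>z\<close>, so
  only the coefficients of \<open>1/z, ..., 1/z ^ k\<close> constrain \<open>P\<close>. The conditions become linear
  equations in \<open>P\<close> alone.
\<close>

lemma hp_interpolates_iff_moments:
  "hp_interpolates f k P \<longleftrightarrow> (\<forall>i<k. moment f i P = 0)"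
proof
  assume "hp_interpolates f k P"
  then obtain Q where Q: "\<And>i. i \<le> int k \<Longrightarrow> fls_nth (f * poly_at_inf P - poly_at_inf Q) i = 0"
    unfolding hp_interpolates_def by blast
  show "\<forall>i<k. moment f i P = 0"
  proof (intro allI impI)
    fix i assume "i < k"
    then show "moment f i P = 0"
      using Q[of "int i + 1"] by (simp add: moment_def fls_nth_poly_at_inf)
  qed
next
  assume mom: "\<forall>i<k. moment f i P = 0"
  obtain Q where Q: "\<And>i. i \<le> 0 \<Longrightarrow> fls_nth (poly_at_inf Q) i = fls_nth (f * poly_at_inf P) i"
    using exists_polynomial_part by blast
  have "fls_nth (f * poly_at_inf P - poly_at_inf Q) i = 0" if "i \<le> int k" for i
  proof (cases "i \<le> 0")
    case True
    then show ?thesis using Q by simp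
  next
    case False
    then have "moment f (nat (i - 1)) P = 0" using mom that by auto
    then show ?thesis using False by (simp add: moment_def fls_nth_poly_at_inf)
  qed
  then show "hp_interpolates f k P" unfolding hp_interpolates_def by blast
qed

lemma smult_independent:
  fixes p q :: "'a::idom poly"
  assumes eq: "smult x p + smult y q = 0" and deg: "degree q < degree p" and "q \<noteq> 0"
  shows "x = 0" "y = 0"
proof -
  have "p \<noteq> 0" using deg by auto
  then show "x = 0"
    using arg_cong[OF eq, of "\<lambda>r. coeff r (degree p)"] deg by (simp add: coeff_eq_0)
  then show "y = 0" using eq \<open>q \<noteq> 0\<close> by simp
qed

lemma three_term_coefficients_unique:
  fixes p q r s :: "'a::idom poly"
  assumes "r = s + smult x p + smult y q" and "r = s + smult x' p + smult y' q"
    and "degree q < degree p" and "q \<noteq> 0"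
  shows "x = x' \<and> y = y'"
proof -
  have "smult (x - x') p + smult (y - y') q
      = (s + smult x p + smult y q) - (s + smult x' p + smult y' q)"
    by (simp add: smult_diff_left)
  also have "\<dots> = 0" unfolding assms(1)[symmetric] assms(2)[symmetric] by simp
  finally show ?thesis using smult_independent assms(3,4) by (metis right_minus_eq)
qed

section \<open>Nearest neighbour recurrences of a perfect system\<close>

locale perfect_pair =
  fixes f1 f2 :: "complex fls"
  assumes perfect: "perfect_system f1 f2"
begin

lemma hermite_pade_degree: "hermite_pade f1 f2 n m R \<Longrightarrow> degree R = n + m"
  using perfect unfolding perfect_system_def normal_index_def by blast

lemma monic_hermite_pade_unique: "\<exists>!P. monic_hermite_pade f1 f2 n m P"
proof -
  obtain P where P: "hermite_pade f1 f2 n m P"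
    and uniq: "\<And>R. hermite_pade f1 f2 n m R \<Longrightarrow> \<exists>r. R = smult r P"
    using perfect unfolding perfect_system_def normal_index_def by meson
  have P0: "P \<noteq> 0" using P by (simp add: hermite_pade_def)
  show ?thesis
  proof
    show "monic_hermite_pade f1 f2 n m (smult (inverse (lead_coeff P)) P)"
      using P P0 by (auto simp: monic_hermite_pade_def hermite_pade_def hp_interpolates_iff_moments)
  next
    fix R assume R: "monic_hermite_pade f1 f2 n m R"
    then obtain r where r: "R = smult r P"
      using uniq unfolding monic_hermite_pade_def by blast
    then have "r * lead_coeff P = 1"
      using R by (auto simp: monic_hermite_pade_def split: if_splits)
    then have "r = inverse (lead_coeff P)" using P0 by (simp add: field_simps)
    then show "R = smult (inverse (lead_coeff P)) P" using r by simp
  qed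
qed

definition hp :: "nat \<Rightarrow> nat \<Rightarrow> complex poly" where
  "hp n m = (THE P. monic_hermite_pade f1 f2 n m P)"

lemma monic_hermite_pade_hp: "monic_hermite_pade f1 f2 n m (hp n m)"
  unfolding hp_def by (rule theI') (rule monic_hermite_pade_unique)

lemma hp_eqI: "monic_hermite_pade f1 f2 n m R \<Longrightarrow> R = hp n m"
  using monic_hermite_pade_unique monic_hermite_pade_hp by blast

lemma degree_hp [simp]: "degree (hp n m) = n + m"
  using monic_hermite_pade_hp hermite_pade_degree unfolding monic_hermite_pade_def by blast

lemma coeff_hp_top [simp]: "coeff (hp n m) (n + m) = 1"
  using monic_hermite_pade_hp[of n m] by (simp add: monic_hermite_pade_def)

lemma hp_nonzero [simp]: "hp n m \<noteq> 0"
  using coeff_hp_top[of n m] by (metis coeff_0 zero_neq_one)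

lemma moment1_hp_eq_0: "k < n \<Longrightarrow> moment f1 k (hp n m) = 0"
  using monic_hermite_pade_hp[of n m]
  by (simp add: monic_hermite_pade_def hermite_pade_def hp_interpolates_iff_moments)

lemma moment2_hp_eq_0: "k < m \<Longrightarrow> moment f2 k (hp n m) = 0"
  using monic_hermite_pade_hp[of n m]
  by (simp add: monic_hermite_pade_def hermite_pade_def hp_interpolates_iff_moments)

text \<open>
  Normality in its working form: the orthogonality conditions, together with the degree bound,
  cut out a line. All recurrences below come from this.
\<close>

lemma orthogonal_imp_multiple:
  assumes deg: "degree R \<le> n + m"
    and mom1: "\<And>k. k < n \<Longrightarrow> moment f1 k R = 0"
    and mom2: "\<And>k. k < m \<Longrightarrow> moment f2 k R = 0"
  obtains r where "R = smult r (hp n m)"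
proof (cases "R = 0")
  case True
  then show ?thesis using that[of 0] by simp
next
  case False
  define R' where "R' = smult (inverse (lead_coeff R)) R"
  have "monic_hermite_pade f1 f2 n m R'"
    using False deg mom1 mom2
    by (auto simp: R'_def monic_hermite_pade_def hermite_pade_def hp_interpolates_iff_moments)
  then have "R' = hp n m" by (rule hp_eqI)
  then have "R = smult (lead_coeff R) (hp n m)"
    using False by (simp add: R'_def flip: \<open>R' = hp n m\<close>)
  then show ?thesis by (rule that)
qed

lemma orthogonal_low_degree_eq_0:
  assumes deg: "degree R < n + m"
    and mom1: "\<And>k. k < n \<Longrightarrow> moment f1 k R = 0"
    and mom2: "\<And>k. k < m \<Longrightarrow> moment f2 k R = 0"
  shows "R = 0"
proof -
  obtain r where r: "R = smult r (hp n m)"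
    using orthogonal_imp_multiple[of R n m] assms by (metis less_imp_le)
  then show ?thesis using deg by (cases "r = 0") auto
qed

text \<open>
  The first moments that are not forced to vanish. They are nonzero, as otherwise the polynomial
  would solve the problem of the next index with too small a degree.
\<close>

definition h1 :: "nat \<Rightarrow> nat \<Rightarrow> complex" where
  "h1 n m = moment f1 n (hp n m)"

definition h2 :: "nat \<Rightarrow> nat \<Rightarrow> complex" where
  "h2 n m = moment f2 m (hp n m)"

lemma h1_nonzero: "h1 n m \<noteq> 0"
proof
  assume "h1 n m = 0"
  then have "hp n m = 0"
    by (intro orthogonal_low_degree_eq_0[of _ "Suc n" m])
      (auto simp: h1_def less_Suc_eq moment1_hp_eq_0 moment2_hp_eq_0)
  then show False by simp
qed

lemma h2_nonzero: "h2 n m \<noteq> 0"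
proof
  assume "h2 n m = 0"
  then have "hp n m = 0"
    by (intro orthogonal_low_degree_eq_0[of _ n "Suc m"])
      (auto simp: h2_def less_Suc_eq moment1_hp_eq_0 moment2_hp_eq_0)
  then show False by simp
qed

lemma hp_neighbours_differ: "hp (Suc n) m \<noteq> hp n (Suc m)"
proof
  assume eq: "hp (Suc n) m = hp n (Suc m)"
  have "hp (Suc n) m = 0"
  proof (rule orthogonal_low_degree_eq_0[of _ "Suc n" "Suc m"])
    show "moment f2 k (hp (Suc n) m) = 0" if "k < Suc m" for k
      using that unfolding eq by (rule moment2_hp_eq_0)
  qed (auto simp: moment1_hp_eq_0)
  then show False by simp
qed

lemma ex_hp_neighbour_difference: "\<exists>e. hp (Suc n) m - hp n (Suc m) = smult e (hp n m)"
proof -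
  let ?R = "hp (Suc n) m - hp n (Suc m)"
  have "degree ?R \<le> n + m"
  proof (rule degree_le, intro allI impI)
    fix i assume "n + m < i"
    then consider "i = Suc n + m" | "Suc n + m < i" by linarith
    then show "coeff ?R i = 0"
    proof cases
      case 1
      then show ?thesis using coeff_hp_top[of "Suc n" m] coeff_hp_top[of n "Suc m"] by simp
    next
      case 2
      then show ?thesis by (simp add: coeff_eq_0)
    qed
  qed
  then show ?thesis
    by (rule orthogonal_imp_multiple) (auto simp: moment1_hp_eq_0 moment2_hp_eq_0)
qed

text \<open>
  Up to sign the denominator \<open>c - d\<close> of the difference equations; in this form it is available,
  and seen to be nonzero, before there is any recurrence.
\<close>

definition gap :: "nat \<Rightarrow> nat \<Rightarrow> complex" where
  "gap n m = (SOME e. hp (Suc n) m - hp n (Suc m) = smult e (hp n m))"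

lemma hp_neighbour_difference: "hp (Suc n) m - hp n (Suc m) = smult (gap n m) (hp n m)"
  unfolding gap_def by (rule someI_ex) (rule ex_hp_neighbour_difference)

lemma gap_nonzero: "gap n m \<noteq> 0"
  using hp_neighbour_difference[of n m] hp_neighbours_differ[of n m] by auto

text \<open>
  The moment of order \<open>n\<close> against \<open>f1\<close> kills \<open>hp (Suc n) m\<close> but neither \<open>hp n (Suc m)\<close>
  nor \<open>hp n m\<close>. Such a factor between \<open>h1\<close> at neighbouring indices, and its mirror image for
  \<open>h2\<close>, becomes a multiplicative difference equation for the quotients \<open>a\<close> and \<open>b\<close>.
\<close>

lemma h1_right: "h1 n (Suc m) = - gap n m * h1 n m"
proof -
  have "- h1 n (Suc m) = gap n m * h1 n m"
    using arg_cong[OF hp_neighbour_difference[of n m], of "moment f1 n"]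
    by (simp add: h1_def moment1_hp_eq_0)
  then show ?thesis by (metis minus_minus mult_minus_left)
qed

lemma h2_up: "h2 (Suc n) m = gap n m * h2 n m"
  using arg_cong[OF hp_neighbour_difference[of n m], of "moment f2 m"]
  by (simp add: h2_def moment2_hp_eq_0)

text \<open>
  The neighbours of smaller index, with 0 in place of the missing ones on the axes, so that the
  recurrences need no case distinction.
\<close>

definition hp_left :: "nat \<Rightarrow> nat \<Rightarrow> complex poly" where
  "hp_left n m = (if n = 0 then 0 else hp (n - 1) m)"

definition hp_below :: "nat \<Rightarrow> nat \<Rightarrow> complex poly" where
  "hp_below n m = (if m = 0 then 0 else hp n (m - 1))"

definition a :: "nat \<Rightarrow> nat \<Rightarrow> complex" where
  "a n m = (if n = 0 then 0 else h1 n m / h1 (n - 1) m)"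

definition b :: "nat \<Rightarrow> nat \<Rightarrow> complex" where
  "b n m = (if m = 0 then 0 else h2 n m / h2 n (m - 1))"

lemma degree_neighbours: "degree (hp_left n m) \<le> n + m" "degree (hp_below n m) \<le> n + m"
  by (auto simp: hp_left_def hp_below_def)

text \<open>
  In \<open>z * hp n m\<close> only one moment against \<open>f1\<close>, of order \<open>n - 1\<close>, and one against \<open>f2\<close>, of
  order \<open>m - 1\<close>, spoil the orthogonality for the index \<open>(n, m)\<close>. The quotients \<open>a n m\<close> and
  \<open>b n m\<close> are chosen so that the two smaller neighbours repair one moment each without
  disturbing the other.
\<close>

lemma ex_recurrence:
  "\<exists>c. pCons 0 (hp n m) =
    hp (Suc n) m + smult c (hp n m) + smult (a n m) (hp_left n m) + smult (b n m) (hp_below n m)"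
proof -
  let ?R = "pCons 0 (hp n m) - hp (Suc n) m - smult (a n m) (hp_left n m)
    - smult (b n m) (hp_below n m)"
  have deg: "degree ?R \<le> n + m"
  proof (rule degree_le, intro allI impI)
    fix i assume i: "n + m < i"
    have "coeff (hp_left n m) i = 0" "coeff (hp_below n m) i = 0"
      using degree_neighbours i by (meson coeff_eq_0 le_less_trans)+
    moreover have "coeff (pCons 0 (hp n m)) i = coeff (hp (Suc n) m) i"
    proof (cases "i = Suc (n + m)")
      case True
      then show ?thesis using coeff_hp_top[of "Suc n" m] by simp
    next
      case False
      then show ?thesis using i by (cases i) (simp_all add: coeff_eq_0)
    qed
    ultimately show "coeff ?R i = 0" by simp
  qed
  have mom1: "moment f1 k ?R = 0" if "k < n" for k
  proof (cases "Suc k = n")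
    case True
    then have "moment f1 k (hp_below n m) = 0" by (simp add: hp_below_def moment1_hp_eq_0)
    moreover have "a n m * moment f1 k (hp_left n m) = moment f1 (Suc k) (hp n m)"
      using True h1_nonzero[of k m] by (auto simp: a_def hp_left_def h1_def)
    ultimately show ?thesis using True by (simp add: moment1_hp_eq_0)
  next
    case False
    then show ?thesis using that by (simp add: hp_left_def hp_below_def moment1_hp_eq_0)
  qed
  have mom2: "moment f2 k ?R = 0" if "k < m" for k
  proof (cases "Suc k = m")
    case True
    then have "moment f2 k (hp_left n m) = 0" by (simp add: hp_left_def moment2_hp_eq_0)
    moreover have "b n m * moment f2 k (hp_below n m) = moment f2 (Suc k) (hp n m)"
      using True h2_nonzero[of n k] by (auto simp: b_def hp_below_def h2_def)
    ultimately show ?thesis using True by (simp add: moment2_hp_eq_0)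
  next
    case False
    then show ?thesis using that by (simp add: hp_left_def hp_below_def moment2_hp_eq_0)
  qed
  obtain c where "?R = smult c (hp n m)"
    using orthogonal_imp_multiple[OF deg mom1 mom2] by blast
  then show ?thesis by (intro exI[of _ c]) (simp add: algebra_simps)
qed

definition c :: "nat \<Rightarrow> nat \<Rightarrow> complex" where
  "c n m = (SOME c. pCons 0 (hp n m) =
    hp (Suc n) m + smult c (hp n m) + smult (a n m) (hp_left n m) + smult (b n m) (hp_below n m))"

definition d :: "nat \<Rightarrow> nat \<Rightarrow> complex" where
  "d n m = c n m + gap n m"

lemma recurrence1:
  "pCons 0 (hp n m) =
    hp (Suc n) m + smult (c n m) (hp n m)
      + smult (a n m) (hp_left n m) + smult (b n m) (hp_below n m)"
  unfolding c_def by (rule someI_ex) (rule ex_recurrence)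

lemma recurrence2:
  "pCons 0 (hp n m) =
    hp n (Suc m) + smult (d n m) (hp n m)
      + smult (a n m) (hp_left n m) + smult (b n m) (hp_below n m)"
proof -
  have "hp n (Suc m) = hp (Suc n) m - smult (gap n m) (hp n m)"
    using hp_neighbour_difference[of n m] by (simp add: algebra_simps)
  then show ?thesis
    by (subst recurrence1) (simp add: d_def smult_add_left)
qed

lemma a_step: "a (Suc n) (Suc m) = a (Suc n) m * (gap (Suc n) m / gap n m)"
  using h1_nonzero gap_nonzero by (simp add: a_def h1_right mult.commute)

lemma b_step: "b (Suc n) (Suc m) = b n (Suc m) * (gap n (Suc m) / gap n m)"
  using h2_nonzero gap_nonzero by (simp add: b_def h2_up mult.commute)

text \<open>
  Expand \<open>z * (hp (Suc n) m - hp n (Suc m))\<close> in two ways: as \<open>gap n m\<close> times the recurrence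
  at \<open>(n, m)\<close>, and by the recurrences at \<open>(Suc n, m)\<close> and \<open>(n, Suc m)\<close>, chosen so that both
  lead to \<open>hp (Suc n) (Suc m)\<close>, which cancels. The remaining polynomials of index not adjacent to
  \<open>(n, m)\<close> are rewritten through neighbour differences, and by \<open>a_step\<close> and \<open>b_step\<close> their
  new terms agree on both sides. What is left is a relation between \<open>hp (Suc n) m\<close> and
  \<open>hp n m\<close>, which have different degrees.
\<close>

lemma compatibility:
  "d (Suc n) m = c n (Suc m) + gap n m"
  "gap n m * (c n (Suc m) - c n m) =
    (a n (Suc m) + b n (Suc m)) - (a (Suc n) m + b (Suc n) m)"
proof -
  let ?S = "(a (Suc n) m + b (Suc n) m) - (a n (Suc m) + b n (Suc m))"
  \<comment> \<open>Move the lower neighbour from column \<open>Suc n\<close> to column \<open>n\<close>.\<close>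
  have A: "smult (b (Suc n) m) (hp_below (Suc n) m) =
    smult (b (Suc n) m) (hp n m) + smult (gap n m) (smult (b n m) (hp_below n m))"
  proof (cases m)
    case 0
    then show ?thesis by (simp add: b_def)
  next
    case (Suc k)
    have "hp (Suc n) k = hp n (Suc k) + smult (gap n k) (hp n k)"
      using hp_neighbour_difference[of n k] by (simp add: algebra_simps)
    then show ?thesis using Suc gap_nonzero[of n k]
      by (simp add: hp_below_def smult_add_right b_step field_simps)
  qed
  \<comment> \<open>Move the left neighbour from row \<open>Suc m\<close> to row \<open>m\<close>.\<close>
  have B: "smult (a n (Suc m)) (hp_left n (Suc m)) =
    smult (a n (Suc m)) (hp n m) - smult (gap n m) (smult (a n m) (hp_left n m))"
  proof (cases n)
    case 0
    then show ?thesis by (simp add: a_def)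
  next
    case (Suc k)
    have "hp k (Suc m) = hp (Suc k) m - smult (gap k m) (hp k m)"
      using hp_neighbour_difference[of k m] by (simp add: algebra_simps)
    then show ?thesis using Suc gap_nonzero[of k m]
      by (simp add: hp_left_def smult_diff_right a_step mult.commute)
  qed
  have next_hp: "hp n (Suc m) = hp (Suc n) m - smult (gap n m) (hp n m)"
    using hp_neighbour_difference[of n m] by (simp add: algebra_simps)
  have "smult (gap n m) (pCons 0 (hp n m)) = pCons 0 (hp (Suc n) m) - pCons 0 (hp n (Suc m))"
    using hp_neighbour_difference[of n m] by (simp flip: hp_neighbour_difference)
  also have "\<dots> = smult (d (Suc n) m) (hp (Suc n) m) + smult (a (Suc n) m) (hp n m)
      + smult (b (Suc n) m) (hp_below (Suc n) m)
      - (smult (c n (Suc m)) (hp n (Suc m)) + smult (a n (Suc m)) (hp_left n (Suc m))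
      + smult (b n (Suc m)) (hp n m))"
    using recurrence2[of "Suc n" m] recurrence1[of n "Suc m"]
    by (simp add: hp_left_def[of "Suc n"] hp_below_def[of n "Suc m"])
  also have "smult (gap n m) (pCons 0 (hp n m)) = smult (gap n m) (hp (Suc n) m + smult (c n m) (hp n m)
      + smult (a n m) (hp_left n m) + smult (b n m) (hp_below n m))"
    by (subst recurrence1) simp
  finally have "smult (d (Suc n) m - c n (Suc m) - gap n m) (hp (Suc n) m)
      + smult (?S + c n (Suc m) * gap n m - gap n m * c n m) (hp n m) = 0"
    unfolding A B unfolding next_hp
    by (simp add: algebra_simps smult_add_right smult_diff_right smult_add_left smult_diff_left)
  from smult_independent[OF this] show "d (Suc n) m = c n (Suc m) + gap n m"
    and "gap n m * (c n (Suc m) - c n m) =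
      (a n (Suc m) + b n (Suc m)) - (a (Suc n) m + b (Suc n) m)"
    by (simp_all add: algebra_simps)
qed

lemma difference_equations_recurrence_coefficients: "difference_equations c d a b"
proof -
  have cd: "c n m - d n m = - gap n m" for n m by (simp add: d_def)
  have c: "c n (Suc m) = c n m +
      ((a (Suc n) m + b (Suc n) m) - (a n (Suc m) + b n (Suc m))) / (c n m - d n m)" for n m
    unfolding cd using compatibility(2)[of n m] gap_nonzero[of n m] by (simp add: field_simps)
  have d: "d (Suc n) m = d n m +
      ((a (Suc n) m + b (Suc n) m) - (a n (Suc m) + b n (Suc m))) / (c n m - d n m)" for n m
    using c[of n m] compatibility(1)[of n m] by (simp add: d_def)
  have a: "a n (Suc m) = a n m * ((c n m - d n m) / (c (n - 1) m - d (n - 1) m))" if "n \<ge> 1" for n m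
    unfolding cd using that by (cases n) (simp_all add: a_step)
  have b: "b (Suc n) m = b n m * ((c n m - d n m) / (c n (m - 1) - d n (m - 1)))" if "m \<ge> 1" for n m
    unfolding cd using that by (cases m) (simp_all add: b_step)
  show ?thesis
    unfolding difference_equations_def Suc_eq_plus1[symmetric]
    using a b c d gap_nonzero cd by auto
qed

end

section \<open>Denominators of a J-fraction\<close>

text \<open>
  Denominators and numerators of the convergents of the J-fraction with entries \<open>\<gamma>\<close> and \<open>\<alpha>\<close>.
\<close>

fun jdenom :: "(nat \<Rightarrow> complex) \<Rightarrow> (nat \<Rightarrow> complex) \<Rightarrow> nat \<Rightarrow> complex poly" where
  "jdenom \<gamma> \<alpha> 0 = 1"
| "jdenom \<gamma> \<alpha> (Suc 0) = pCons 0 1 - smult (\<gamma> 0) 1"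
| "jdenom \<gamma> \<alpha> (Suc (Suc k)) =
    pCons 0 (jdenom \<gamma> \<alpha> (Suc k)) - smult (\<gamma> (Suc k)) (jdenom \<gamma> \<alpha> (Suc k))
      - smult (\<alpha> (Suc k)) (jdenom \<gamma> \<alpha> k)"

fun jnumer :: "(nat \<Rightarrow> complex) \<Rightarrow> (nat \<Rightarrow> complex) \<Rightarrow> nat \<Rightarrow> complex poly" where
  "jnumer \<gamma> \<alpha> 0 = 0"
| "jnumer \<gamma> \<alpha> (Suc 0) = 1"
| "jnumer \<gamma> \<alpha> (Suc (Suc k)) =
    pCons 0 (jnumer \<gamma> \<alpha> (Suc k)) - smult (\<gamma> (Suc k)) (jnumer \<gamma> \<alpha> (Suc k))
      - smult (\<alpha> (Suc k)) (jnumer \<gamma> \<alpha> k)"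

lemma jdenom_monic: "degree (jdenom \<gamma> \<alpha> k) = k \<and> coeff (jdenom \<gamma> \<alpha> k) k = 1"
proof (induction k rule: induct_nat_012)
  case (ge2 k)
  let ?p = "jdenom \<gamma> \<alpha> (Suc (Suc k))"
  have top: "coeff ?p (Suc (Suc k)) = 1"
    using ge2 by (simp add: coeff_eq_0)
  have "degree ?p \<le> Suc (Suc k)"
  proof (rule degree_le, intro allI impI)
    fix i assume "Suc (Suc k) < i"
    then show "coeff ?p i = 0"
      using ge2 by (cases i) (simp_all add: coeff_eq_0)
  qed
  moreover have "Suc (Suc k) \<le> degree ?p"
    using top by (intro le_degree) simp
  ultimately show ?case using top by (simp del: jdenom.simps)
qed (simp_all add: one_pCons)

lemma fls_mult_nth_eq_0:
  fixes f g :: "'a::idom fls"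
  assumes f: "\<And>i. i < r \<Longrightarrow> fls_nth f i = 0" and g: "\<And>i. i < s \<Longrightarrow> fls_nth g i = 0"
    and "i < r + s"
  shows "fls_nth (f * g) i = 0"
proof (cases "f = 0 \<or> g = 0")
  case True
  then show ?thesis by auto
next
  case False
  then have "r \<le> fls_subdegree f" "s \<le> fls_subdegree g"
    using f g by (auto intro: fls_subdegree_geI)
  then show ?thesis using \<open>i < r + s\<close> False by (intro fls_eq0_below_subdegree) simp
qed

text \<open>
  Every truncated tail is \<open>O(1/z)\<close>, hence each denominator is \<open>z + O(1)\<close>. In particular it is
  nonzero, so that the defining quotient may be cleared of it.
\<close>

lemma jfrac_conv_Suc:
  shows jfrac_conv_nth_eq_0: "i < 1 \<Longrightarrow> fls_nth (jfrac_conv \<gamma> \<alpha> N k) i = 0"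
    and jfrac_conv_Suc_mult: "jfrac_conv \<gamma> \<alpha> (Suc N) k *
      (fls_X_inv - fls_const (\<gamma> k) - fls_const (\<alpha> (k + 1)) * jfrac_conv \<gamma> \<alpha> N (k + 1)) = 1"
proof -
  define D where "D N k =
    fls_X_inv - fls_const (\<gamma> k) - fls_const (\<alpha> (k + 1)) * jfrac_conv \<gamma> \<alpha> N (k + 1)" for N k
  have D: "D N k \<noteq> 0 \<and> fls_subdegree (D N k) = - 1"
    if "\<And>i. i < 1 \<Longrightarrow> fls_nth (jfrac_conv \<gamma> \<alpha> N (k + 1)) i = 0" for N k
  proof -
    have "fls_nth (D N k) (- 1) \<noteq> 0" using that by (simp add: D_def)
    moreover have "fls_nth (D N k) i = 0" if "i < - 1" for i
      using that \<open>\<And>i. i < 1 \<Longrightarrow> fls_nth (jfrac_conv \<gamma> \<alpha> N (k + 1)) i = 0\<close> by (simp add: D_def)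
    ultimately show ?thesis by (metis fls_subdegree_eqI fls_zero_nth)
  qed
  have vanish: "fls_nth (jfrac_conv \<gamma> \<alpha> N k) i = 0" if "i < 1" for N k i
    using that
  proof (induction N arbitrary: k i)
    case 0
    then show ?case by simp
  next
    case (Suc N)
    have eq: "jfrac_conv \<gamma> \<alpha> (Suc N) k = inverse (D N k)"
      by (simp add: D_def field_simps)
    have "fls_subdegree (D N k) = - 1" using D Suc.IH by blast
    then have "fls_subdegree (inverse (D N k)) = 1" by simp
    then show ?case unfolding eq using Suc.prems by (intro fls_eq0_below_subdegree) simp
  qed
  show "i < 1 \<Longrightarrow> fls_nth (jfrac_conv \<gamma> \<alpha> N k) i = 0" by (rule vanish)
  have "D N k \<noteq> 0" using D vanish by blast
  then show "jfrac_conv \<gamma> \<alpha> (Suc N) k *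
      (fls_X_inv - fls_const (\<gamma> k) - fls_const (\<alpha> (k + 1)) * jfrac_conv \<gamma> \<alpha> N (k + 1)) = 1"
    by (simp add: D_def)
qed

text \<open>
  The product of the first \<open>k + 1\<close> truncated tails and of the first \<open>k\<close> partial numerators. The
  length \<open>N - Suc k\<close> is that of the tail which starts at level \<open>Suc k\<close> inside a fraction
  with \<open>N\<close> levels.
\<close>

primrec jfrac_tail_product ::
    "(nat \<Rightarrow> complex) \<Rightarrow> (nat \<Rightarrow> complex) \<Rightarrow> nat \<Rightarrow> nat \<Rightarrow> complex fls" where
  "jfrac_tail_product \<gamma> \<alpha> N 0 = jfrac_conv \<gamma> \<alpha> N 0"
| "jfrac_tail_product \<gamma> \<alpha> N (Suc k) =
    fls_const (\<alpha> (Suc k)) * jfrac_conv \<gamma> \<alpha> (N - Suc k) (Suc k) * jfrac_tail_product \<gamma> \<alpha> N k"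

lemma jfrac_tail_product_nth_eq_0:
  "i < int k + 1 \<Longrightarrow> fls_nth (jfrac_tail_product \<gamma> \<alpha> N k) i = 0"
proof (induction k arbitrary: i)
  case 0
  then show ?case by (simp add: jfrac_conv_nth_eq_0)
next
  case (Suc k)
  have "fls_nth (jfrac_conv \<gamma> \<alpha> (N - Suc k) (Suc k) * jfrac_tail_product \<gamma> \<alpha> N k) i = 0"
    using Suc.prems
    by (intro fls_mult_nth_eq_0[where r = 1 and s = "int k + 1"])
      (auto simp: jfrac_conv_nth_eq_0 Suc.IH)
  then show ?case by (simp add: mult.assoc)
qed

text \<open>
  Both sides satisfy the three-term recurrence of the denominators: for the product of the tails
  \<open>F\<close>, this is \<open>F k * (z - \<gamma> k - \<alpha> (k + 1) * F (k + 1)) = 1\<close>, multiplied by the earlier factors.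
  As each tail is \<open>O(1/z)\<close>, the remainder has the order required of an interpolating
  denominator. The condition \<open>k < N\<close> keeps every tail that is expanded nonempty.
\<close>

lemma jfrac_remainder_eq_tail_product:
  "k < N \<Longrightarrow> jfrac_conv \<gamma> \<alpha> N 0 * poly_at_inf (jdenom \<gamma> \<alpha> k) - poly_at_inf (jnumer \<gamma> \<alpha> k)
    = jfrac_tail_product \<gamma> \<alpha> N k"
proof (induction k rule: induct_nat_012)
  case 0
  then show ?case by (simp add: one_pCons poly_at_inf_pCons)
next
  case 1
  then obtain M where N: "N = Suc M" by (cases N) auto
  have "jfrac_conv \<gamma> \<alpha> N 0 * (fls_X_inv - fls_const (\<gamma> 0))
      - fls_const (\<alpha> 1) * jfrac_conv \<gamma> \<alpha> M 1 * jfrac_conv \<gamma> \<alpha> N 0 = 1"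
    using jfrac_conv_Suc_mult[of \<gamma> \<alpha> M 0] unfolding N
    by (simp add: algebra_simps del: jfrac_conv.simps)
  then show ?case
    by (simp add: N one_pCons poly_at_inf_pCons poly_at_inf_diff poly_at_inf_smult algebra_simps
      del: jfrac_conv.simps)
next
  case (ge2 k)
  define F where "F = jfrac_conv \<gamma> \<alpha> N 0"
  define u where "u = jfrac_conv \<gamma> \<alpha> (N - Suc k) (Suc k)"
  define v where "v = jfrac_conv \<gamma> \<alpha> (N - Suc (Suc k)) (Suc (Suc k))"
  have "N - Suc k = Suc (N - Suc (Suc k))" using ge2.prems by simp
  then have uv: "u * (fls_X_inv - fls_const (\<gamma> (Suc k)) - fls_const (\<alpha> (Suc (Suc k))) * v) = 1"
    using jfrac_conv_Suc_mult[of \<gamma> \<alpha> "N - Suc (Suc k)" "Suc k"]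
    unfolding u_def v_def by (simp del: jfrac_conv.simps)
  let ?\<psi> = "jfrac_tail_product \<gamma> \<alpha> N"
  have IH0: "F * poly_at_inf (jdenom \<gamma> \<alpha> k) - poly_at_inf (jnumer \<gamma> \<alpha> k) = ?\<psi> k"
    and IH1: "F * poly_at_inf (jdenom \<gamma> \<alpha> (Suc k)) - poly_at_inf (jnumer \<gamma> \<alpha> (Suc k)) = ?\<psi> (Suc k)"
    using ge2 by (simp_all add: F_def del: jfrac_tail_product.simps)
  have "F * poly_at_inf (jdenom \<gamma> \<alpha> (Suc (Suc k))) - poly_at_inf (jnumer \<gamma> \<alpha> (Suc (Suc k)))
      = (fls_X_inv - fls_const (\<gamma> (Suc k))) * ?\<psi> (Suc k) - fls_const (\<alpha> (Suc k)) * ?\<psi> k"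
    unfolding IH0[symmetric] IH1[symmetric] jdenom.simps jnumer.simps
      poly_at_inf_pCons poly_at_inf_diff poly_at_inf_smult
    by (simp add: algebra_simps)
  also have "\<dots> = fls_const (\<alpha> (Suc k)) * ?\<psi> k * (u * (fls_X_inv - fls_const (\<gamma> (Suc k))) - 1)"
    by (simp add: u_def algebra_simps)
  also have "u * (fls_X_inv - fls_const (\<gamma> (Suc k))) - 1 = fls_const (\<alpha> (Suc (Suc k))) * v * u"
    using uv by (simp add: algebra_simps)
  finally show ?case
    by (simp add: F_def u_def v_def mult_ac)
qed

text \<open>
  Convergence in the adic metric makes each coefficient eventually constant. A finite stage thus
  suffices below, and no infinite tail of the J-fraction has to be constructed.
\<close>

lemma fls_tendsto_imp_coeffs_agree:
  assumes "X \<longlonglongrightarrow> (f :: complex fls)"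
  shows "\<forall>\<^sub>F N in sequentially. \<forall>i \<le> int M. fls_nth (X N) i = fls_nth f i"
proof -
  have "\<forall>\<^sub>F N in sequentially. dist (X N) f < inverse (2 ^ M)"
    using assms by (rule tendstoD) simp
  then show ?thesis
  proof eventually_elim
    case (elim N)
    show ?case
    proof (cases "X N = f")
      case False
      have sub: "int M < fls_subdegree (X N - f)"
      proof (cases "fls_subdegree (X N - f) \<ge> 0")
        case True
        then have "inverse (2 ^ nat (fls_subdegree (X N - f))) < (inverse (2 ^ M) :: real)"
          using elim False by (simp add: dist_fls_def)
        then have "(2::real) ^ M < 2 ^ nat (fls_subdegree (X N - f))"
          by (simp add: field_simps)
        then show ?thesis by simp
      next
        case neg: False
        have "inverse (2 ^ M) \<le> (1 :: real)" by (simp add: field_simps)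
        also have "\<dots> \<le> dist (X N) f" using neg False by (simp add: dist_fls_def)
        finally show ?thesis using elim by simp
      qed
      have "fls_nth (X N - f) i = 0" if "i \<le> int M" for i
        using sub that by (intro fls_eq0_below_subdegree) simp
      then show ?thesis by simp
    qed simp
  qed
qed

text \<open>
  Replace \<open>f\<close> by a convergent that agrees with it up to \<open>1/z ^ (2 * k)\<close>. As the denominator has
  degree \<open>k\<close>, the error is \<open>O(1/z ^ (k + 1))\<close>, which does not reach the relevant coefficients,
  and for the convergent the remainder is the product of the tails.
\<close>

lemma jdenom_interpolates:
  assumes "has_jfrac f \<gamma> \<alpha>"
  shows "hp_interpolates f k (jdenom \<gamma> \<alpha> k)"
  unfolding hp_interpolates_iff_moments
proof (intro allI impI)
  fix j assume j: "j < k"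
  let ?p = "poly_at_inf (jdenom \<gamma> \<alpha> k)"
  have "\<forall>\<^sub>F N in sequentially. \<forall>i \<le> int (2 * k).
      fls_nth (- jfrac_conv \<gamma> \<alpha> N 0) i = fls_nth f i"
    using assms by (intro fls_tendsto_imp_coeffs_agree) (simp add: has_jfrac_def)
  moreover have "\<forall>\<^sub>F N in sequentially. k < N" by (rule eventually_gt_at_top)
  ultimately have ev: "\<forall>\<^sub>F N in sequentially.
      k < N \<and> (\<forall>i \<le> int (2 * k). fls_nth (- jfrac_conv \<gamma> \<alpha> N 0) i = fls_nth f i)"
    by eventually_elim simp
  from eventually_happens'[OF sequentially_bot ev] obtain N where N: "k < N"
    and agree: "\<And>i. i \<le> int (2 * k) \<Longrightarrow> fls_nth (- jfrac_conv \<gamma> \<alpha> N 0) i = fls_nth f i"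
    by blast
  let ?F = "jfrac_conv \<gamma> \<alpha> N 0"
  have "fls_nth ((f + ?F) * ?p) (int j + 1) = 0"
  proof (rule fls_mult_nth_eq_0[where r = "2 * int k + 1" and s = "- int k"])
    show "fls_nth (f + ?F) i = 0" if "i < 2 * int k + 1" for i
    proof -
      have "fls_nth f i = - fls_nth ?F i" using agree[of i] that by simp
      then show ?thesis by simp
    qed
    show "fls_nth ?p i = 0" if "i < - int k" for i
      using that jdenom_monic[of \<gamma> \<alpha> k] by (simp add: fls_nth_poly_at_inf coeff_eq_0)
  qed (use j in simp)
  moreover have "fls_nth (?F * ?p) (int j + 1) = 0"
  proof -
    have "?F * ?p = jfrac_tail_product \<gamma> \<alpha> N k + poly_at_inf (jnumer \<gamma> \<alpha> k)"
      using jfrac_remainder_eq_tail_product[OF N, of \<gamma> \<alpha>] by (simp add: algebra_simps)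
    then show ?thesis
      using j by (simp add: jfrac_tail_product_nth_eq_0 fls_nth_poly_at_inf)
  qed
  moreover have "f * ?p = (f + ?F) * ?p - ?F * ?p" by (simp add: algebra_simps)
  ultimately show "moment f j (jdenom \<gamma> \<alpha> k) = 0" by (simp add: moment_def)
qed

context perfect_pair
begin

lemma hp_first_axis:
  assumes "has_jfrac f1 \<gamma> \<alpha>"
  shows "hp n 0 = jdenom \<gamma> \<alpha> n"
proof -
  have "monic_hermite_pade f1 f2 n 0 (jdenom \<gamma> \<alpha> n)"
    using jdenom_interpolates[OF assms, of n] jdenom_monic[of \<gamma> \<alpha> n]
    by (auto simp: monic_hermite_pade_def hermite_pade_def hp_interpolates_iff_moments[of f2])
  then show ?thesis by (rule hp_eqI[symmetric])
qed

lemma hp_second_axis: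
  assumes "has_jfrac f2 \<gamma> \<alpha>"
  shows "hp 0 m = jdenom \<gamma> \<alpha> m"
proof -
  have "monic_hermite_pade f1 f2 0 m (jdenom \<gamma> \<alpha> m)"
    using jdenom_interpolates[OF assms, of m] jdenom_monic[of \<gamma> \<alpha> m]
    by (auto simp: monic_hermite_pade_def hermite_pade_def hp_interpolates_iff_moments[of f1])
  then show ?thesis by (rule hp_eqI[symmetric])
qed

lemma first_axis_coefficients:
  assumes "has_jfrac f1 \<gamma> \<alpha>"
  shows "c n 0 = \<gamma> n" "a (Suc n) 0 = \<alpha> (Suc n)"
proof -
  note hp = hp_first_axis[OF assms]
  have step: "c (Suc k) 0 = \<gamma> (Suc k) \<and> a (Suc k) 0 = \<alpha> (Suc k)" for k
  proof -
    have "pCons 0 (hp (Suc k) 0) = hp (Suc (Suc k)) 0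
        + smult (c (Suc k) 0) (hp (Suc k) 0) + smult (a (Suc k) 0) (hp k 0)"
      using recurrence1[of "Suc k" 0] by (simp add: b_def hp_left_def)
    moreover have "pCons 0 (hp (Suc k) 0) = hp (Suc (Suc k)) 0
        + smult (\<gamma> (Suc k)) (hp (Suc k) 0) + smult (\<alpha> (Suc k)) (hp k 0)"
      by (simp add: hp)
    ultimately show ?thesis by (rule three_term_coefficients_unique) simp_all
  qed
  have "c 0 0 = \<gamma> 0"
  proof -
    have "hp 0 0 = 1" "hp (Suc 0) 0 = pCons 0 1 - smult (\<gamma> 0) 1" by (simp_all only: hp jdenom.simps)
    then have "smult (c 0 0 - \<gamma> 0) (1 :: complex poly) = 0"
      using recurrence1[of 0 0] by (simp add: a_def b_def smult_diff_left)
    then show ?thesis by simp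
  qed
  then show "c n 0 = \<gamma> n" using step by (cases n) auto
  show "a (Suc n) 0 = \<alpha> (Suc n)" using step by simp
qed

lemma second_axis_coefficients:
  assumes "has_jfrac f2 \<gamma> \<alpha>"
  shows "d 0 m = \<gamma> m" "b 0 (Suc m) = \<alpha> (Suc m)"
proof -
  note hp = hp_second_axis[OF assms]
  have step: "d 0 (Suc k) = \<gamma> (Suc k) \<and> b 0 (Suc k) = \<alpha> (Suc k)" for k
  proof -
    have "pCons 0 (hp 0 (Suc k)) = hp 0 (Suc (Suc k))
        + smult (d 0 (Suc k)) (hp 0 (Suc k)) + smult (b 0 (Suc k)) (hp 0 k)"
      using recurrence2[of 0 "Suc k"] by (simp add: a_def hp_below_def)
    moreover have "pCons 0 (hp 0 (Suc k)) = hp 0 (Suc (Suc k))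
        + smult (\<gamma> (Suc k)) (hp 0 (Suc k)) + smult (\<alpha> (Suc k)) (hp 0 k)"
      by (simp add: hp)
    ultimately show ?thesis by (rule three_term_coefficients_unique) simp_all
  qed
  have "d 0 0 = \<gamma> 0"
  proof -
    have "hp 0 0 = 1" "hp 0 (Suc 0) = pCons 0 1 - smult (\<gamma> 0) 1" by (simp_all only: hp jdenom.simps)
    then have "smult (d 0 0 - \<gamma> 0) (1 :: complex poly) = 0"
      using recurrence2[of 0 0] by (simp add: a_def b_def smult_diff_left)
    then show ?thesis by simp
  qed
  then show "d 0 m = \<gamma> m" using step by (cases m) auto
  show "b 0 (Suc m) = \<alpha> (Suc m)" using step by simp
qed

end

section \<open>Branched continued fractions\<close>

text \<open>
  One level of a branched continued fraction is a linear relation between polynomials. The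
  equivalence serves both existence (from right to left) and uniqueness (from left to right) of the
  expansions. It survives the convention \<open>1 / 0 = 0\<close>: the left-hand quotient is nonzero, so
  the equation excludes a vanishing denominator.
\<close>

lemma continued_fraction_step_iff:
  fixes p q l r :: "complex poly"
  assumes p: "p \<noteq> 0" and q: "q \<noteq> 0"
    and A: "A * to_fract p = - to_fract l" and B: "B * to_fract p = - to_fract r"
  shows "- (to_fract p / to_fract q) = - 1 / (ratfun_z - ratfun_const x + A + B) \<longleftrightarrow>
    pCons 0 p = q + smult x p + l + r"
proof -
  let ?W = "ratfun_z - ratfun_const x + A + B"
  have W: "?W * to_fract p = to_fract (pCons 0 p - smult x p - l - r)"
  proof -
    have "?W * to_fract p = ratfun_z * to_fract p - ratfun_const x * to_fract p
        + A * to_fract p + B * to_fract p"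
      by (simp add: algebra_simps)
    also have "\<dots> = to_fract ([:0, 1:] * p - [:x:] * p - l - r)"
      unfolding A B by (simp only: to_fract_diff to_fract_mult) simp
    finally show ?thesis by simp
  qed
  have "- (to_fract p / to_fract q) = - 1 / ?W \<longleftrightarrow> ?W * to_fract p = to_fract q"
  proof (cases "?W = 0")
    case True
    then show ?thesis using p q by simp
  next
    case False
    then show ?thesis using q by (simp add: frac_eq_eq mult.commute)
  qed
  also have "\<dots> \<longleftrightarrow> pCons 0 p = q + smult x p + l + r"
    unfolding W to_fract_eq_iff by (auto simp: algebra_simps)
  finally show ?thesis .
qed

context perfect_pair
begin

lemma left_branch:
  "(if n = 0 then 0 else ratfun_const x * m_minus1 hp (n - 1) m) * to_fract (hp n m)
    = - to_fract (smult x (hp_left n m))"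
proof (cases n)
  case (Suc k)
  have "to_fract (smult x (hp k m)) = ratfun_const x * to_fract (hp k m)"
    by (simp flip: to_fract_mult)
  then show ?thesis using Suc by (simp add: m_minus1_def hp_left_def)
qed (simp add: hp_left_def)

lemma below_branch:
  "(if m = 0 then 0 else ratfun_const x * m_minus2 hp n (m - 1)) * to_fract (hp n m)
    = - to_fract (smult x (hp_below n m))"
proof (cases m)
  case (Suc k)
  have "to_fract (smult x (hp n k)) = ratfun_const x * to_fract (hp n k)"
    by (simp flip: to_fract_mult)
  then show ?thesis using Suc by (simp add: m_minus2_def hp_below_def)
qed (simp add: hp_below_def)

lemma m_minus1_step_iff:
  "m_minus1 hp n m = - 1 / (ratfun_z - ratfun_const x
      + (if n = 0 then 0 else ratfun_const y * m_minus1 hp (n - 1) m)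
      + (if m = 0 then 0 else ratfun_const z * m_minus2 hp n (m - 1))) \<longleftrightarrow>
    pCons 0 (hp n m) = hp (Suc n) m + smult x (hp n m)
      + smult y (hp_left n m) + smult z (hp_below n m)"
  unfolding m_minus1_def[of hp n m] Suc_eq_plus1[symmetric]
  by (intro continued_fraction_step_iff left_branch below_branch) simp_all

lemma m_minus2_step_iff:
  "m_minus2 hp n m = - 1 / (ratfun_z - ratfun_const x
      + (if n = 0 then 0 else ratfun_const y * m_minus1 hp (n - 1) m)
      + (if m = 0 then 0 else ratfun_const z * m_minus2 hp n (m - 1))) \<longleftrightarrow>
    pCons 0 (hp n m) = hp n (Suc m) + smult x (hp n m)
      + smult y (hp_left n m) + smult z (hp_below n m)"
  unfolding m_minus2_def[of hp n m] Suc_eq_plus1[symmetric]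
  by (intro continued_fraction_step_iff left_branch below_branch) simp_all

text \<open>
  Unfolding each fraction once gives the recurrences. They give back the fractions by induction on
  \<open>n + m\<close>, since a step only refers to values of smaller total index.
\<close>

lemma has_bcf_expansions_iff:
  "has_bcf_expansions hp c' d' a' b' \<longleftrightarrow>
    (\<forall>m. a' 0 m = 0) \<and> (\<forall>n. b' n 0 = 0) \<and>
    (\<forall>n m. pCons 0 (hp n m) = hp (Suc n) m + smult (c' n m) (hp n m)
        + smult (a' n m) (hp_left n m) + smult (b' n m) (hp_below n m) \<and>
      pCons 0 (hp n m) = hp n (Suc m) + smult (d' n m) (hp n m)
        + smult (a' n m) (hp_left n m) + smult (b' n m) (hp_below n m))"
  (is "_ \<longleftrightarrow> _ \<and> _ \<and> ?rec")
proof -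
  let ?m1 = "m_minus1 hp" and ?m2 = "m_minus2 hp"
  have "(\<forall>n m. ?m1 n m = bcf1 c' d' a' b' n m \<and> ?m2 n m = bcf2 c' d' a' b' n m) \<longleftrightarrow> ?rec"
    (is "?bcf \<longleftrightarrow> _")
  proof
    assume bcf: ?bcf
    show ?rec
      unfolding m_minus1_step_iff[symmetric] m_minus2_step_iff[symmetric]
    proof (intro allI conjI)
      fix n m
      show "?m1 n m = - 1 / (ratfun_z - ratfun_const (c' n m)
          + (if n = 0 then 0 else ratfun_const (a' n m) * ?m1 (n - 1) m)
          + (if m = 0 then 0 else ratfun_const (b' n m) * ?m2 n (m - 1)))"
        using bcf bcf1.simps[of c' d' a' b' n m] by simp
      show "?m2 n m = - 1 / (ratfun_z - ratfun_const (d' n m)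
          + (if n = 0 then 0 else ratfun_const (a' n m) * ?m1 (n - 1) m)
          + (if m = 0 then 0 else ratfun_const (b' n m) * ?m2 n (m - 1)))"
        using bcf bcf2.simps[of c' d' a' b' n m] by simp
    qed
  next
    assume ?rec
    note step = this[unfolded m_minus1_step_iff[symmetric] m_minus2_step_iff[symmetric], rule_format]
    have "?m1 n m = bcf1 c' d' a' b' n m \<and> ?m2 n m = bcf2 c' d' a' b' n m" for n m
    proof (induction "n + m" arbitrary: n m rule: less_induct)
      case less
      have L: "(if n = 0 then 0 else ratfun_const (a' n m) * ?m1 (n - 1) m) =
          (if n = 0 then 0 else ratfun_const (a' n m) * bcf1 c' d' a' b' (n - 1) m)"
        using less[of "n - 1" m] by simp
      have B: "(if m = 0 then 0 else ratfun_const (b' n m) * ?m2 n (m - 1)) =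
          (if m = 0 then 0 else ratfun_const (b' n m) * bcf2 c' d' a' b' n (m - 1))"
        using less[of n "m - 1"] by simp
      show ?case
        using step[of n m] unfolding L B bcf1.simps[of c' d' a' b' n m] bcf2.simps[of c' d' a' b' n m]
        by blast
    qed
    then show ?bcf by blast
  qed
  then show ?thesis unfolding has_bcf_expansions_def by blast
qed

lemma has_bcf_expansions_recurrence_coefficients: "has_bcf_expansions hp c d a b"
  unfolding has_bcf_expansions_iff using recurrence1 recurrence2 by (simp add: a_def b_def)

text \<open>
  The leading coefficient at degree \<open>n + m\<close> fixes \<open>x\<close>. The two smaller neighbours have equal
  degree, so that degrees do not separate them; they are independent because their difference
  is a nonzero multiple of a polynomial of lower degree. On an axis one of them is 0 and does not
  determine its coefficient, which explains the last two assumptions.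
\<close>

lemma recurrence_coefficients_unique:
  assumes rec: "p = q + smult x (hp n m) + smult y (hp_left n m) + smult z (hp_below n m)"
    and rec': "p = q + smult x' (hp n m) + smult y' (hp_left n m) + smult z' (hp_below n m)"
    and y0: "n = 0 \<Longrightarrow> y = y'" and z0: "m = 0 \<Longrightarrow> z = z'"
  shows "x = x' \<and> y = y' \<and> z = z'"
proof -
  have "smult (x - x') (hp n m) + smult (y - y') (hp_left n m) + smult (z - z') (hp_below n m)
      = (q + smult x (hp n m) + smult y (hp_left n m) + smult z (hp_below n m))
        - (q + smult x' (hp n m) + smult y' (hp_left n m) + smult z' (hp_below n m))"
    by (simp add: smult_diff_left)
  also have "\<dots> = 0" unfolding rec[symmetric] rec'[symmetric] by simp
  finally have eq: "smult (x - x') (hp n m) + smult (y - y') (hp_left n m)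
      + smult (z - z') (hp_below n m) = 0" .
  have low: "coeff (hp_left n m) (n + m) = 0" "coeff (hp_below n m) (n + m) = 0"
    by (auto simp: hp_left_def hp_below_def intro!: coeff_eq_0)
  have x: "x = x'"
    using arg_cong[OF eq, of "\<lambda>p. coeff p (n + m)"] low by simp
  show ?thesis
  proof (cases "n = 0 \<or> m = 0")
    case True
    then show ?thesis
      using eq x y0 z0 by (auto simp: hp_left_def hp_below_def split: if_splits)
  next
    case False
    then obtain i j where n: "n = Suc i" and m: "m = Suc j" by (metis not0_implies_Suc)
    have "hp (Suc i) j = hp i (Suc j) + smult (gap i j) (hp i j)"
      using hp_neighbour_difference[of i j] by (simp add: algebra_simps)
    then have "smult (y - y' + (z - z')) (hp i (Suc j)) + smult ((z - z') * gap i j) (hp i j) = 0"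
      using eq x by (simp add: n m hp_left_def hp_below_def smult_add_left smult_add_right add.assoc)
    from smult_independent[OF this] have "y - y' + (z - z') = 0" "(z - z') * gap i j = 0" by simp_all
    then show ?thesis using x gap_nonzero[of i j] by simp
  qed
qed

lemma has_bcf_expansions_unique:
  assumes "has_bcf_expansions hp c' d' a' b'"
  shows "c' = c \<and> d' = d \<and> a' = a \<and> b' = b"
proof -
  have zero: "a' 0 m = a 0 m" "b' n 0 = b n 0" for n m
    using assms by (simp_all add: has_bcf_expansions_def a_def b_def)
  have rec: "pCons 0 (hp n m) = hp (Suc n) m + smult (c' n m) (hp n m)
        + smult (a' n m) (hp_left n m) + smult (b' n m) (hp_below n m)"
      "pCons 0 (hp n m) = hp n (Suc m) + smult (d' n m) (hp n m)
        + smult (a' n m) (hp_left n m) + smult (b' n m) (hp_below n m)" for n m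
    using assms unfolding has_bcf_expansions_iff by metis+
  have "c' n m = c n m \<and> a' n m = a n m \<and> b' n m = b n m" for n m
    by (rule recurrence_coefficients_unique[OF rec(1) recurrence1]) (auto simp: zero)
  moreover have "d' n m = d n m \<and> a' n m = a n m \<and> b' n m = b n m" for n m
    by (rule recurrence_coefficients_unique[OF rec(2) recurrence2]) (auto simp: zero)
  ultimately show ?thesis by (simp add: fun_eq_iff)
qed

end

theorem proposition5p2:
  fixes ch dh ah bh s1 s2 :: "nat \<Rightarrow> complex"
  assumes "corresponds_to_perfect ch dh ah bh s1 s2"
  shows "\<exists>c d a b :: nat \<Rightarrow> nat \<Rightarrow> complex.
    difference_equations c d a b \<and> boundary_conditions ch dh ah bh c d a b \<and>
    (\<forall>n. a (n+1) 0 = ah (n+1) \<and> ah (n+1) \<noteq> 0) \<and>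
    (\<forall>m. b 0 (m+1) = bh (m+1) \<and> bh (m+1) \<noteq> 0) \<and>
    (\<exists>P :: nat \<Rightarrow> nat \<Rightarrow> complex poly.
      (\<forall>n m. monic_hermite_pade (series_at_inf s1) (series_at_inf s2) n m (P n m)) \<and>
      (\<forall>t1 t2 R. corresponds_to_perfect ch dh ah bh t1 t2 \<and>
         (\<forall>n m. monic_hermite_pade (series_at_inf t1) (series_at_inf t2) n m (R n m)) \<longrightarrow> R = P) \<and>
      has_bcf_expansions P c d a b \<and>
      (\<forall>c' d' a' b'. has_bcf_expansions P c' d' a' b' \<longrightarrow>
         c' = c \<and> d' = d \<and> a' = a \<and> b' = b))"
proof -
  define f1 f2 where "f1 = series_at_inf s1" and "f2 = series_at_inf s2"
  have jf1: "has_jfrac f1 ch ah" and jf2: "has_jfrac f2 dh bh"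
    using assms by (simp_all add: corresponds_to_perfect_def f1_def f2_def)
  interpret perfect_pair f1 f2
    using assms by unfold_locales (simp add: corresponds_to_perfect_def f1_def f2_def)
  have boundary: "boundary_conditions ch dh ah bh c d a b"
    using first_axis_coefficients[OF jf1] second_axis_coefficients[OF jf2]
    by (simp add: boundary_conditions_def a_def[of 0] b_def[of _ 0])
  have nonzero: "ah (n + 1) \<noteq> 0" "bh (n + 1) \<noteq> 0" for n
    using jf1 jf2 by (simp_all add: has_jfrac_def)
  have determined: "R = hp"
    if "corresponds_to_perfect ch dh ah bh t1 t2"
      and R: "\<forall>n m. monic_hermite_pade (series_at_inf t1) (series_at_inf t2) n m (R n m)" for t1 t2 R
  proof -
    have "series_at_inf t1 = f1" "series_at_inf t2 = f2"
      using that(1) jf1 jf2 LIMSEQ_unique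
      unfolding corresponds_to_perfect_def has_jfrac_def by blast+
    then show ?thesis using R hp_eqI by (simp add: fun_eq_iff)
  qed
  show ?thesis
    unfolding f1_def[symmetric] f2_def[symmetric]
  proof (rule exI[of _ c], rule exI[of _ d], rule exI[of _ a], rule exI[of _ b],
      intro conjI exI[of _ hp])
    show "\<forall>n. a (n + 1) 0 = ah (n + 1) \<and> ah (n + 1) \<noteq> 0"
      and "\<forall>m. b 0 (m + 1) = bh (m + 1) \<and> bh (m + 1) \<noteq> 0"
      using boundary nonzero unfolding boundary_conditions_def by blast+
    show "\<forall>t1 t2 R. corresponds_to_perfect ch dh ah bh t1 t2 \<and>
        (\<forall>n m. monic_hermite_pade (series_at_inf t1) (series_at_inf t2) n m (R n m)) \<longrightarrow> R = hp"
      using determined by blast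
    show "\<forall>n m. monic_hermite_pade f1 f2 n m (hp n m)"
      using monic_hermite_pade_hp by blast
    show "\<forall>c' d' a' b'. has_bcf_expansions hp c' d' a' b' \<longrightarrow> c' = c \<and> d' = d \<and> a' = a \<and> b' = b"
      using has_bcf_expansions_unique by blast
  qed (rule difference_equations_recurrence_coefficients boundary
      has_bcf_expansions_recurrence_coefficients)+
qed

end
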